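(* Let $L$ be a finite comodernistic lattice. Then $L$ has a $CL$-labeling.
   Context: All lattices are finite. An element $m$ of a lattice $L$ is left-modular if $(x\vee m)\wedge y=x\vee(m\wedge y)$ for all $x<y$ in $L$. A lattice is comodernistic if every interval $[u,v]$ of it has a coatom which is left-modular as an element of the lattice $[u,v]$. Write $x\lessdot y$ if $y$ covers $x$. A rooted cover relation is a cover relation $x\lessdot y$ together with a maximal chain from $\hat{0}$ to $x$ (the root); a rooted interval $[x,y]_{\mathbf r}$ is an interval together with a maximal chain $\mathbf r$ from $\hat 0$ to $x$. A chain-edge labeling assigns an integer to each rooted cover relation; each maximal chain $x=x_0\lessdot x_1\lessdot\cdots\lessdot x_k=y$ of a rooted interval $[x,y]_{\mathbf r}$ then gets the word whose $j$-th letter is the label of $x_{j-1}\lessdot x_j$ rooted at $\mathbf r\cup\{x_1,\dots,x_{j-1}\}$. A maximal chain is increasing if its word is strictly increasing; maximal chains are compared by lexicographic order of their words. A $CL$-labeling is a chain-edge labeling such that in every rooted interval $[x,y]_{\mathbf r}$ there is a unique increasing maximal chain, and it is strictly lexicographically earlier than every other maximal chain of $[x,y]_{\mathbf r}$. *)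

theory Defs
  imports Main
begin

definition covered_by :: "'a::order \<Rightarrow> 'a \<Rightarrow> bool"
  where "covered_by x y \<longleftrightarrow> x < y \<and> (\<nexists>z. x < z \<and> z < y)"

(* Joins and meets of elements of {u..v} formed in the interval agree with those
   of the ambient lattice, so the ambient operations are used. *)
definition left_modular_in :: "'a::lattice set \<Rightarrow> 'a \<Rightarrow> bool"
  where "left_modular_in S m \<longleftrightarrow>
    m \<in> S \<and> (\<forall>x\<in>S. \<forall>y\<in>S. x < y \<longrightarrow> inf (sup x m) y = sup x (inf m y))"

definition coatom_of_interval :: "'a::order \<Rightarrow> 'a \<Rightarrow> 'a \<Rightarrow> bool"
  where "coatom_of_interval u v m \<longleftrightarrow> m \<in> {u..v} \<and> covered_by m v"

(* One-element intervals have no coatoms, hence u < v. *)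
definition comodernistic :: "'a::{finite,bounded_lattice} itself \<Rightarrow> bool"
  where "comodernistic _ \<longleftrightarrow>
    (\<forall>u v :: 'a. u < v \<longrightarrow> (\<exists>m. coatom_of_interval u v m \<and> left_modular_in {u..v} m))"

(* Maximal chains of [x,y] are written as lists x = x_0, x_1, ..., x_k = y. *)
definition maximal_chain :: "'a::order \<Rightarrow> 'a \<Rightarrow> 'a list \<Rightarrow> bool"
  where "maximal_chain x y c \<longleftrightarrow>
    c \<noteq> [] \<and> hd c = x \<and> last c = y \<and> successively covered_by c"

(* l r y is the label of the cover relation from x to y rooted at r, where x is the
   last element of the root r. Values of l away from rooted cover relations play no role. *)
type_synonym 'a chain_edge_labeling = "'a list \<Rightarrow> 'a \<Rightarrow> int"

(* For a chain c = [x_0, ..., x_k] and a root r ending in x_0, the j-th letter has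
   root r extended by x_1, ..., x_(j-1). *)
definition chain_word :: "'a chain_edge_labeling \<Rightarrow> 'a list \<Rightarrow> 'a list \<Rightarrow> int list"
  where "chain_word l r c = map (\<lambda>j. l (r @ take (j - 1) (tl c)) (c ! j)) [1..<length c]"

definition increasing_chain :: "'a chain_edge_labeling \<Rightarrow> 'a list \<Rightarrow> 'a list \<Rightarrow> bool"
  where "increasing_chain l r c \<longleftrightarrow> sorted_wrt (<) (chain_word l r c)"

definition CL_labeling :: "'a::{finite,bounded_lattice} chain_edge_labeling \<Rightarrow> bool"
  where "CL_labeling l \<longleftrightarrow>
    (\<forall>x y r. x \<le> y \<longrightarrow> maximal_chain bot x r \<longrightarrow>
      (\<exists>!c. maximal_chain x y c \<and> increasing_chain l r c) \<and>
      (\<forall>c c'. maximal_chain x y c \<and> increasing_chain l r c \<and> maximal_chain x y c' \<and> c' \<noteq> c \<longrightarrow>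
        ord_class.lexordp (chain_word l r c) (chain_word l r c')))"

end

theory Submission
  imports Defs
begin

text \<open>
  A chain from \<open>x\<close> to \<open>v\<close> is built downwards by choosing, below each of its elements \<open>m\<close>, a
  left-modular coatom of \<open>[x, m]\<close>. Attach such a chain \<open>M\<close> from \<open>x\<close> to the top to every root
  ending in \<open>x\<close>, and label a cover \<open>x \<lessdot> a\<close> by (a linear extension of) the least \<open>\<mu> \<in> M\<close>
  above \<open>a\<close>. When the root is extended by \<open>a\<close>, the part of \<open>M\<close> above \<open>\<mu>\<close> is kept, since it
  consists of left-modular coatoms over \<open>a\<close> as well, and only the part below \<open>\<mu>\<close> is chosen
  afresh. Left-modularity makes \<open>y \<sqinter> m\<close>, for the first \<open>m \<in> M\<close> with \<open>y \<sqinter> m > x\<close>, the unique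
  atom of \<open>[x, y]\<close> with smallest label. After this atom all labels get larger, while any other
  atom \<open>a\<close> lies properly below \<open>y \<sqinter> \<mu>\<close>, so that the smallest label over \<open>a\<close> is at most that
  of \<open>a\<close> itself.
\<close>

section \<open>Chains attached to roots, and the labeling\<close>

text \<open>Left-modularity of \<open>m'\<close> is asked for only in \<open>{x..m}\<close>, with
  \<open>m\<close> the next element up and the lower end always \<open>x\<close>: this is what
  comodernism supplies. A set rather than a list makes cutting and gluing such chains easy.\<close>

definition left_modular_chain :: "'a::lattice \<Rightarrow> 'a \<Rightarrow> 'a set \<Rightarrow> bool"
  where "left_modular_chain x v M \<longleftrightarrow>
    M \<subseteq> {x..v} \<and> x \<in> M \<and> v \<in> M \<and> (\<forall>p\<in>M. \<forall>q\<in>M. p \<le> q \<or> q \<le> p) \<and>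
    (\<forall>m\<in>M - {x}. \<exists>m'\<in>M. covered_by m' m \<and> left_modular_in {x..m} m')"

definition least_above :: "'a::order set \<Rightarrow> 'a \<Rightarrow> 'a"
  where "least_above M a = (LEAST m. m \<in> M \<and> a \<le> m)"

text \<open>The two pieces share the element \<open>least_above M a\<close>. Keeping the upper piece
  makes labels before and after the extension of the root comparable; the lower piece is
  arbitrary.\<close>

definition extend_chain :: "'a::lattice set \<Rightarrow> 'a \<Rightarrow> 'a set"
  where "extend_chain M a =
    (SOME N. left_modular_chain a (least_above M a) N) \<union> {m \<in> M. least_above M a \<le> m}"

text \<open>The chain always ends in \<open>top\<close>, so labels do not depend on the upper end of
  an interval. The initial chain already belongs to the first element \<open>bot\<close> of a root,
  hence \<open>tl\<close>.\<close>

definition root_chain :: "'a::{finite,bounded_lattice} list \<Rightarrow> 'a set"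
  where "root_chain r = foldl extend_chain (SOME M. left_modular_chain bot top M) (tl r)"

text \<open>The size of the principal ideal is a strictly monotone map to the integers, so it
  preserves and reflects order on each chain.\<close>

definition comodernistic_labeling :: "'a::{finite,bounded_lattice} chain_edge_labeling"
  where "comodernistic_labeling r a = int (card {..least_above (root_chain r) a})"

section \<open>Finite orders\<close>

lemma card_atMost_less:
  fixes p q :: "'a::{finite,order}"
  assumes "p < q"
  shows "card {..p} < card {..q}"
proof (rule psubset_card_mono)
  show "{..p} \<subset> {..q}"
    using assms by (metis atMost_subset_iff less_le_not_le psubsetI subset_refl)
qed simp

lemma card_atMost_le:
  fixes p q :: "'a::{finite,order}"
  assumes "p \<le> q"
  shows "card {..p} \<le> card {..q}"
  using assms by (intro card_mono) auto

lemma ex_covered_by_le: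
  fixes x y :: "'a::{finite,order}"
  assumes "x < y"
  obtains a where "covered_by x a" "a \<le> y"
proof -
  have "finite {z. x < z \<and> z \<le> y}" "{z. x < z \<and> z \<le> y} \<noteq> {}"
    using assms by auto
  then obtain a where a: "a \<in> {z. x < z \<and> z \<le> y}"
      "\<forall>b\<in>{z. x < z \<and> z \<le> y}. b \<le> a \<longrightarrow> a = b"
    using finite_has_minimal by metis
  then have "covered_by x a"
    unfolding covered_by_def by (auto dest: order.strict_trans2 order.strict_implies_order)
  with a show ?thesis using that by blast
qed

lemma chain_has_least:
  fixes S :: "'a::{finite,order} set"
  assumes "S \<noteq> {}" "\<forall>p\<in>S. \<forall>q\<in>S. p \<le> q \<or> q \<le> p"
  obtains s where "s \<in> S" "\<forall>q\<in>S. s \<le> q"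
proof -
  obtain s where "s \<in> S" "\<forall>b\<in>S. b \<le> s \<longrightarrow> s = b"
    using finite_has_minimal[OF _ assms(1)] by auto
  then show ?thesis using assms(2) that by metis
qed

section \<open>Existence and extension of left-modular chains\<close>

lemma least_above:
  fixes M :: "'a::{finite,lattice} set"
  assumes "left_modular_chain x v M" "a \<le> v"
  shows "least_above M a \<in> M" "a \<le> least_above M a"
    and "\<And>m. m \<in> M \<Longrightarrow> a \<le> m \<Longrightarrow> least_above M a \<le> m"
proof -
  have "{m \<in> M. a \<le> m} \<noteq> {}" "\<forall>p\<in>{m \<in> M. a \<le> m}. \<forall>q\<in>{m \<in> M. a \<le> m}. p \<le> q \<or> q \<le> p"
    using assms unfolding left_modular_chain_def by auto
  then obtain s where s: "s \<in> {m \<in> M. a \<le> m}" "\<forall>q\<in>{m \<in> M. a \<le> m}. s \<le> q"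
    by (rule chain_has_least)
  then have "least_above M a = s"
    unfolding least_above_def by (intro Least_equality) auto
  with s show "least_above M a \<in> M" "a \<le> least_above M a"
    "\<And>m. m \<in> M \<Longrightarrow> a \<le> m \<Longrightarrow> least_above M a \<le> m" by auto
qed

text \<open>Below a left-modular coatom \<open>m\<close> of \<open>{x..v}\<close> a chain exists by
  induction. Adding \<open>v\<close> on top leaves the conditions on its other elements unchanged,
  since they concern intervals starting at \<open>x\<close>.\<close>

lemma ex_left_modular_chain:
  fixes x v :: "'a::{finite,bounded_lattice}"
  assumes "comodernistic TYPE('a)" "x \<le> v"
  shows "\<exists>M. left_modular_chain x v M"
  using assms(2)
proof (induction "card {..v}" arbitrary: v rule: less_induct)
  case less
  show ?case
  proof (cases "x = v")
    case True
    then have "left_modular_chain x v {x}" unfolding left_modular_chain_def by auto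
    then show ?thesis by blast
  next
    case False
    with less.prems have "x < v" by simp
    then obtain m where m: "x \<le> m" "covered_by m v" "left_modular_in {x..v} m"
      using assms(1) unfolding comodernistic_def coatom_of_interval_def by auto
    then have "m < v" by (simp add: covered_by_def)
    then obtain M where M: "left_modular_chain x m M"
      using less.hyps[OF card_atMost_less] m(1) by blast
    have le: "q \<le> v" if "q \<in> M" for q
      using M \<open>m < v\<close> that unfolding left_modular_chain_def by fastforce
    have "left_modular_chain x v (insert v M)"
      using M m le less.prems unfolding left_modular_chain_def by auto
    then show ?thesis by blast
  qed
qed

text \<open>For elements above \<open>a\<close>, left-modularity in \<open>{x..m}\<close> passes to
  \<open>{a..m}\<close>, where the identity is tested on fewer pairs. So the part of
  \<open>M\<close> above \<open>s\<close> remains valid, and it is glued at \<open>s\<close> to a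
  new chain from \<open>a\<close> to \<open>s\<close>.\<close>

lemma left_modular_chain_extend:
  fixes M :: "'a::{finite,bounded_lattice} set"
  assumes "comodernistic TYPE('a)" and M: "left_modular_chain x v M"
    and "x \<le> a" "a \<le> v"
  shows "left_modular_chain a v (extend_chain M a)"
proof -
  define s where "s = least_above M a"
  have s: "s \<in> M" "a \<le> s" "\<And>m. m \<in> M \<Longrightarrow> a \<le> m \<Longrightarrow> s \<le> m"
    using least_above[OF M \<open>a \<le> v\<close>] by (auto simp: s_def)
  define N where "N = (SOME N. left_modular_chain a s N)"
  have N: "left_modular_chain a s N"
    unfolding N_def using ex_left_modular_chain[OF assms(1) s(2)] by (rule someI_ex)
  have E: "extend_chain M a = N \<union> {m \<in> M. s \<le> m}"
    by (simp add: extend_chain_def N_def s_def)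
  have N_le: "a \<le> q" "q \<le> s" if "q \<in> N" for q
    using N that by (auto simp: left_modular_chain_def)
  have M_le: "q \<le> v" if "q \<in> M" for q
    using M that by (auto simp: left_modular_chain_def)
  have "\<exists>m'\<in>N \<union> {m \<in> M. s \<le> m}. covered_by m' m \<and> left_modular_in {a..m} m'"
    if m: "m \<in> N \<union> {m \<in> M. s \<le> m}" "m \<noteq> a" for m
  proof (cases "m \<in> N")
    case True
    then show ?thesis using N m(2) unfolding left_modular_chain_def by blast
  next
    case False
    then have "m \<in> M" "s \<le> m" using m by auto
    moreover have "s \<in> N" using N by (simp add: left_modular_chain_def)
    ultimately have "s < m" using False by (metis order.not_eq_order_implies_strict)
    then have "m \<noteq> x" using s(2) \<open>x \<le> a\<close> by auto
    then obtain m' where m': "m' \<in> M" "covered_by m' m" "left_modular_in {x..m} m'"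
      using M \<open>m \<in> M\<close> unfolding left_modular_chain_def by blast
    have "s \<le> m' \<or> m' \<le> s" using M s(1) m'(1) unfolding left_modular_chain_def by blast
    \<comment> \<open>Otherwise \<open>s\<close> would lie strictly between \<open>m'\<close> and
      its cover \<open>m\<close>. Hence \<open>m'\<close> is among the elements kept.\<close>
    then have "s \<le> m'" using m'(2) \<open>s < m\<close> unfolding covered_by_def by (metis order.order_iff_strict)
    then have "left_modular_in {a..m} m'"
      using m'(2,3) s(2) \<open>x \<le> a\<close> unfolding left_modular_in_def covered_by_def by auto
    then show ?thesis using m' \<open>s \<le> m'\<close> by blast
  qed
  moreover have "p \<le> q \<or> q \<le> p" if "p \<in> N \<union> {m \<in> M. s \<le> m}" "q \<in> N \<union> {m \<in> M. s \<le> m}" for p q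
  proof -
    have "p \<le> q" if "p \<in> N" "q \<in> M" "s \<le> q" for p q
      using N_le(2)[OF that(1)] that(3) by (rule order_trans)
    with that N M show ?thesis unfolding left_modular_chain_def by blast
  qed
  moreover have "N \<union> {m \<in> M. s \<le> m} \<subseteq> {a..v}"
    using N_le(1) order_trans[OF N_le(2) M_le[OF s(1)]] M_le order_trans[OF s(2)] by auto
  moreover have "a \<in> N" "v \<in> M"
    using N M by (auto simp: left_modular_chain_def)
  moreover have "s \<le> v" using M_le s(1) .
  ultimately show ?thesis unfolding E left_modular_chain_def by blast
qed

text \<open>The element that determines the label of \<open>a\<close> survives in the new chain, so
  it can be compared with those determining the labels of covers of \<open>a\<close>.\<close>

lemma least_above_mem_extend_chain:
  fixes M :: "'a::{finite,lattice} set"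
  assumes "left_modular_chain x v M" "a \<le> v"
  shows "least_above M a \<in> extend_chain M a"
  using least_above(1)[OF assms] by (simp add: extend_chain_def)

lemma root_chain_snoc:
  assumes "r \<noteq> []"
  shows "root_chain (r @ [a]) = extend_chain (root_chain r) a"
  using assms by (simp add: root_chain_def)

lemma maximal_chain_snoc:
  assumes "maximal_chain w x r" "covered_by x a"
  shows "maximal_chain w a (r @ [a])"
  using assms unfolding maximal_chain_def by (auto simp: successively_append_iff)

lemma left_modular_chain_root_chain:
  fixes x :: "'a::{finite,bounded_lattice}"
  assumes "comodernistic TYPE('a)" "maximal_chain bot x r"
  shows "left_modular_chain x top (root_chain r)"
  using assms(2)
proof (induction r arbitrary: x rule: rev_induct)
  case Nil
  then show ?case by (simp add: maximal_chain_def)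
next
  case (snoc a r)
  then have "a = x" by (simp add: maximal_chain_def)
  show ?case
  proof (cases "r = []")
    case True
    with snoc.prems have "x = bot" by (auto simp: maximal_chain_def)
    moreover have "left_modular_chain bot top (SOME M. left_modular_chain bot (top::'a) M)"
      by (intro someI_ex[of "left_modular_chain bot top"] ex_left_modular_chain[OF assms(1)]) simp
    ultimately show ?thesis using True by (simp add: root_chain_def)
  next
    case False
    then have "maximal_chain bot (last r) r" and cov: "covered_by (last r) x"
      using snoc.prems by (auto simp: maximal_chain_def successively_append_iff)
    then have "left_modular_chain (last r) top (root_chain r)" using snoc.IH by blast
    moreover have "last r \<le> x" using cov by (auto simp: covered_by_def)
    ultimately show ?thesis
      using left_modular_chain_extend[OF assms(1)] False \<open>a = x\<close> by (simp add: root_chain_snoc)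
  qed
qed

section \<open>The atom with the smallest label\<close>

text \<open>Take the least \<open>s\<close> in \<open>M\<close> with \<open>inf y s\<close> above
  \<open>x\<close>, and its predecessor \<open>m\<close> in \<open>M\<close>, for which
  \<open>inf y m = x\<close>. Left-modularity of \<open>m\<close> in \<open>{x..s}\<close> forces
  \<open>inf y s\<close> to be an atom over \<open>x\<close>. Any other atom \<open>a\<close> below
  \<open>y\<close> satisfies \<open>a \<le> inf y (least_above M a)\<close>, so it cannot appear at
  or before \<open>s\<close>.\<close>

lemma ex_first_atom:
  fixes M :: "'a::{finite,lattice} set"
  assumes M: "left_modular_chain x v M" and "x < y" "y \<le> v"
  obtains a0 where "covered_by x a0" "a0 = inf y (least_above M a0)"
    and "\<And>a. covered_by x a \<Longrightarrow> a \<le> y \<Longrightarrow> a \<noteq> a0 \<Longrightarrow> least_above M a0 < least_above M a"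
proof -
  have x_le: "x \<le> q" if "q \<in> M" for q
    using M that by (auto simp: left_modular_chain_def)
  have "{m \<in> M. x < inf y m} \<noteq> {}"
    using assms by (auto simp: left_modular_chain_def inf_absorb1)
  moreover have "\<forall>p\<in>{m \<in> M. x < inf y m}. \<forall>q\<in>{m \<in> M. x < inf y m}. p \<le> q \<or> q \<le> p"
    using M by (auto simp: left_modular_chain_def)
  ultimately obtain s where s': "s \<in> {m \<in> M. x < inf y m}" "\<forall>q\<in>{m \<in> M. x < inf y m}. s \<le> q"
    by (rule chain_has_least)
  then have s: "s \<in> M" "x < inf y s"
      and s_le: "\<And>q. q \<in> M \<Longrightarrow> x < inf y q \<Longrightarrow> s \<le> q"
    by auto
  define a0 where "a0 = inf y s"
  have "s \<noteq> x" using s(2) by (metis inf.cobounded2 leD)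
  then obtain m where m: "m \<in> M" "covered_by m s" "left_modular_in {x..s} m"
    using M s(1) unfolding left_modular_chain_def by blast
  \<comment> \<open>Since \<open>m < s\<close>, this is the minimality of \<open>s\<close>.\<close>
  have "\<not> x < inf y m" using s_le[OF m(1)] m(2) by (auto simp: covered_by_def)
  then have ym: "inf y m = x"
    using x_le[OF m(1)] \<open>x < y\<close> by (simp add: less_le)
  have cov: "covered_by x a0"
    unfolding covered_by_def
  proof (intro conjI notI)
    show "x < a0" using s(2) by (simp add: a0_def)
    assume "\<exists>z. x < z \<and> z < a0"
    then obtain z where z: "x < z" "z < a0" by blast
    have le: "z \<le> y" "z \<le> s" "a0 \<le> s" "a0 \<le> y"
      using z(2) by (auto simp: a0_def less_le)
    have "\<not> z \<le> m" using ym z(1) le(1) by (metis inf.boundedI leD)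
    then have "m < sup z m" by (metis sup.cobounded1 sup.cobounded2 order.not_eq_order_implies_strict)
    moreover have "sup z m \<le> s" using le(2) m(2) by (auto simp: covered_by_def)
    ultimately have "sup z m = s"
      using m(2) by (metis covered_by_def order.not_eq_order_implies_strict)
    \<comment> \<open>The left side is \<open>inf s a0 = a0\<close>, and the right side is
      \<open>z\<close> because \<open>inf m a0 \<le> x < z\<close>.\<close>
    moreover have "inf (sup z m) a0 = sup z (inf m a0)"
      using m(3) z le unfolding left_modular_in_def by auto
    moreover have "inf m a0 \<le> x"
      using ym le(4) by (metis inf.commute inf_mono order_refl)
    ultimately have "a0 = z"
      using z(1) le(3) by (simp add: inf_absorb2 sup_absorb1)
    then show False using z(2) by simp
  qed
  have "a0 \<le> v" using \<open>y \<le> v\<close> by (simp add: a0_def le_infI1)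
  have least: "least_above M a0 = s"
  proof (rule order.antisym)
    show "least_above M a0 \<le> s"
      using least_above(3)[OF M \<open>a0 \<le> v\<close>] s(1) by (simp add: a0_def)
    have "a0 \<le> inf y (least_above M a0)"
      using least_above(2)[OF M \<open>a0 \<le> v\<close>] by (simp add: a0_def)
    then show "s \<le> least_above M a0"
      using s_le least_above(1)[OF M \<open>a0 \<le> v\<close>] s(2) a0_def by (simp add: less_le_trans)
  qed
  have "s < least_above M a" if a: "covered_by x a" "a \<le> y" "a \<noteq> a0" for a
  proof -
    have "a \<le> v" using a(2) \<open>y \<le> v\<close> by simp
    have "x < a" using a(1) by (simp add: covered_by_def)
    have "a \<le> inf y (least_above M a)" using least_above(2)[OF M \<open>a \<le> v\<close>] a(2) by simp
    then have "s \<le> least_above M a"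
      using s_le[OF least_above(1)[OF M \<open>a \<le> v\<close>] less_le_trans[OF \<open>x < a\<close>]] by blast
    moreover have "s = least_above M a \<Longrightarrow> a \<le> a0"
      using \<open>a \<le> inf y (least_above M a)\<close> by (simp add: a0_def)
    moreover have "\<not> a \<le> a0"
      using cov \<open>x < a\<close> a(3) by (auto simp: covered_by_def less_le)
    ultimately show ?thesis by (auto simp: less_le)
  qed
  with cov least show ?thesis using that by (simp add: a0_def)
qed

section \<open>Maximal chains and their words\<close>

lemma maximal_chain_le:
  assumes "maximal_chain x y c"
  shows "x \<le> y"
  using assms
proof (induction c arbitrary: x)
  case Nil
  then show ?case by (simp add: maximal_chain_def)
next
  case (Cons z c)
  show ?case
  proof (cases c)
    case Nil
    with Cons.prems show ?thesis by (auto simp: maximal_chain_def)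
  next
    case (Cons a c')
    then have "maximal_chain a y c" "covered_by x a"
      using Cons.prems by (auto simp: maximal_chain_def)
    then show ?thesis using Cons.IH by (fastforce simp: covered_by_def)
  qed
qed

text \<open>The case \<open>x = y\<close> is excluded because the chain \<open>[x]\<close> has no
  second element.\<close>

lemma maximal_chain_Cons_iff:
  assumes "x \<noteq> y"
  shows "maximal_chain x y c \<longleftrightarrow> (\<exists>a c'. c = x # c' \<and> covered_by x a \<and> maximal_chain a y c')"
proof
  assume c: "maximal_chain x y c"
  then obtain c' where "c = x # c'" by (cases c) (auto simp: maximal_chain_def)
  with c assms show "\<exists>a c'. c = x # c' \<and> covered_by x a \<and> maximal_chain a y c'"
    by (cases c') (auto simp: maximal_chain_def)
next
  assume "\<exists>a c'. c = x # c' \<and> covered_by x a \<and> maximal_chain a y c'"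
  then obtain a c' where "c = x # c'" "covered_by x a" "maximal_chain a y c'" by blast
  then show "maximal_chain x y c"
    by (cases c') (auto simp: maximal_chain_def)
qed

lemma maximal_chain_refl_iff: "maximal_chain x x c \<longleftrightarrow> c = [x]"
proof
  assume c: "maximal_chain x x c"
  then obtain c' where c': "c = x # c'" by (cases c) (auto simp: maximal_chain_def)
  show "c = [x]"
  proof (cases c')
    case (Cons a d)
    then have "maximal_chain a x c'" "covered_by x a"
      using c c' by (auto simp: maximal_chain_def)
    then show ?thesis using maximal_chain_le by (fastforce simp: covered_by_def)
  qed (simp add: c')
qed (simp add: maximal_chain_def)

lemma chain_word_singleton [simp]: "chain_word l r [x] = []"
  by (simp add: chain_word_def)

lemma chain_word_Cons_Cons [simp]:
  "chain_word l r (x # a # c) = l r a # chain_word l (r @ [a]) (a # c)"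
proof -
  \<comment> \<open>Letter \<open>j + 1\<close> of the longer chain is letter \<open>j\<close> of
    the shorter one, whose root has absorbed \<open>a\<close>.\<close>
  have "[1..<length (x # a # c)] = 1 # map Suc [1..<length (a # c)]"
    by (simp add: upt_conv_Cons map_Suc_upt del: upt_Suc)
  moreover have "take (Suc j - 1) (tl (x # a # c)) = a # take (j - 1) c" if "1 \<le> j" for j
    using that by (cases j) auto
  ultimately show ?thesis
    unfolding chain_word_def by (simp del: upt_Suc)
qed

lemma chain_word_Cons:
  assumes "maximal_chain a y c"
  shows "chain_word l r (x # c) = l r a # chain_word l (r @ [a]) c"
  using assms by (cases c) (auto simp: maximal_chain_def)

lemma increasing_chain_Cons_iff:
  assumes "maximal_chain a y c"
  shows "increasing_chain l r (x # c) \<longleftrightarrow>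
    (\<forall>k\<in>set (chain_word l (r @ [a]) c). l r a < k) \<and> increasing_chain l (r @ [a]) c"
  unfolding increasing_chain_def by (simp add: chain_word_Cons[OF assms])

section \<open>Labels of consecutive covers\<close>

text \<open>Both \<open>?s\<close> and \<open>?t\<close> lie in the chain of the extended root, so
  they are comparable. If \<open>?t \<le> ?s\<close>, then \<open>b\<close> would be below
  \<open>inf y ?s = a\<close>, although it covers \<open>a\<close>.\<close>

lemma comodernistic_labeling_first_atom_less:
  fixes x y :: "'a::{finite,bounded_lattice}"
  assumes "comodernistic TYPE('a)" and r: "maximal_chain bot x r" and a: "covered_by x a"
    and inf: "a = inf y (least_above (root_chain r) a)" and b: "covered_by a b" "b \<le> y"
  shows "comodernistic_labeling r a < comodernistic_labeling (r @ [a]) b"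
proof -
  have M: "left_modular_chain x top (root_chain r)"
    using left_modular_chain_root_chain assms(1) r .
  have M': "left_modular_chain a top (root_chain (r @ [a]))"
    using left_modular_chain_root_chain[OF assms(1) maximal_chain_snoc[OF r a]] .
  have "r \<noteq> []" using r by (simp add: maximal_chain_def)
  let ?s = "least_above (root_chain r) a" and ?t = "least_above (root_chain (r @ [a])) b"
  have t: "?t \<in> root_chain (r @ [a])" "b \<le> ?t" using least_above[OF M'] by auto
  have "?s \<in> root_chain (r @ [a])"
    using least_above_mem_extend_chain[OF M] \<open>r \<noteq> []\<close> by (simp add: root_chain_snoc)
  then have "?s \<le> ?t \<or> ?t \<le> ?s"
    using M' t(1) unfolding left_modular_chain_def by blast
  moreover have "\<not> ?t \<le> ?s"
  proof
    assume "?t \<le> ?s"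
    then have "b \<le> inf y ?s" using b(2) t(2) by auto
    then have "b \<le> a" using inf by simp
    then show False using b(1) by (auto simp: covered_by_def)
  qed
  ultimately have "?s < ?t" by (auto simp: less_le)
  then show ?thesis by (simp add: comodernistic_labeling_def card_atMost_less)
qed

text \<open>Both \<open>a\<close> and \<open>b\<close> are below \<open>?s\<close>, hence so is a
  cover \<open>d\<close> of \<open>a\<close> below \<open>sup a b\<close>. As \<open>?s\<close>
  stays in the extended chain, the label of \<open>d\<close> is at most that of \<open>a\<close>.
  This rules out increasing chains through \<open>a\<close>.\<close>

lemma ex_descent_after_other_atom:
  fixes x y :: "'a::{finite,bounded_lattice}"
  assumes "comodernistic TYPE('a)" and r: "maximal_chain bot x r"
    and a: "covered_by x a" "a \<le> y" and b: "covered_by x b" "b \<le> y" "b \<noteq> a"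
    and less: "least_above (root_chain r) b < least_above (root_chain r) a"
  obtains d where "covered_by a d" "d \<le> y"
    and "comodernistic_labeling (r @ [a]) d \<le> comodernistic_labeling r a"
proof -
  have M: "left_modular_chain x top (root_chain r)"
    using left_modular_chain_root_chain assms(1) r .
  have M': "left_modular_chain a top (root_chain (r @ [a]))"
    using left_modular_chain_root_chain[OF assms(1) maximal_chain_snoc[OF r a(1)]] .
  have "r \<noteq> []" using r by (simp add: maximal_chain_def)
  let ?s = "least_above (root_chain r) a"
  have "\<not> b \<le> a" using a(1) b(1,3) by (auto simp: covered_by_def less_le)
  then have "a < sup a b" by (metis sup.cobounded1 sup.cobounded2 order.not_eq_order_implies_strict)
  then obtain d where d: "covered_by a d" "d \<le> sup a b" by (rule ex_covered_by_le)
  have "a \<le> ?s" "b \<le> ?s"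
    using least_above(2)[OF M top_greatest] less by (auto intro: order_trans less_imp_le)
  then have "d \<le> ?s" using d(2) by (meson le_supI order_trans)
  moreover have "?s \<in> root_chain (r @ [a])"
    using least_above_mem_extend_chain[OF M] \<open>r \<noteq> []\<close> by (simp add: root_chain_snoc)
  ultimately have "least_above (root_chain (r @ [a])) d \<le> ?s"
    using least_above(3)[OF M'] by simp
  then have "comodernistic_labeling (r @ [a]) d \<le> comodernistic_labeling r a"
    by (simp add: comodernistic_labeling_def card_atMost_le)
  moreover have "d \<le> y" using d(2) a(2) b(2) by (meson le_supI order_trans)
  ultimately show ?thesis using that d(1) by blast
qed

section \<open>Increasing chains and lexicographic order\<close>

lemma ex_maximal_chain:
  fixes x y :: "'a::{finite,order}"
  assumes "x \<le> y"
  shows "\<exists>c. maximal_chain x y c"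
  using assms
proof (induction "card {x..y}" arbitrary: x rule: less_induct)
  case less
  show ?case
  proof (cases "x = y")
    case False
    with less.prems have "x < y" by simp
    then obtain a where a: "covered_by x a" "a \<le> y" by (rule ex_covered_by_le)
    then have "x < a" by (simp add: covered_by_def)
    then have "card {a..y} < card {x..y}"
      using less.prems by (intro psubset_card_mono) (auto simp: psubset_eq)
    then show ?thesis using less.hyps a False by (metis maximal_chain_Cons_iff)
  qed (auto simp: maximal_chain_refl_iff)
qed

text \<open>Existence, uniqueness and lexicographic minimality are proved in one induction over
  intervals, for all roots at once. The increasing chain passes through the first atom; minimality
  over another atom is what excludes a second increasing chain.\<close>

lemma comodernistic_labeling_increasing_chain:
  fixes x y :: "'a::{finite,bounded_lattice}"
  assumes "comodernistic TYPE('a)" "x \<le> y" "maximal_chain bot x r"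
  shows "\<exists>c. maximal_chain x y c \<and> increasing_chain comodernistic_labeling r c \<and>
    (\<forall>c'. maximal_chain x y c' \<and> c' \<noteq> c \<longrightarrow> \<not> increasing_chain comodernistic_labeling r c' \<and>
      ord_class.lexordp (chain_word comodernistic_labeling r c)
        (chain_word comodernistic_labeling r c'))"
  using assms(2,3)
proof (induction "card {x..y}" arbitrary: x r rule: less_induct)
  case less
  let ?l = comodernistic_labeling
  note r = less.prems(2)
  show ?case
  proof (cases "x = y")
    case True
    then show ?thesis
      by (auto simp: maximal_chain_refl_iff increasing_chain_def)
  next
    case False
    with less.prems have "x < y" by simp
    have IH: "\<exists>c. maximal_chain a y c \<and> increasing_chain ?l (r @ [a]) c \<and>
      (\<forall>c'. maximal_chain a y c' \<and> c' \<noteq> c \<longrightarrow> \<not> increasing_chain ?l (r @ [a]) c' \<and>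
        ord_class.lexordp (chain_word ?l (r @ [a]) c) (chain_word ?l (r @ [a]) c'))"
      if a: "covered_by x a" "a \<le> y" for a
    proof -
      have "x < a" using a by (simp add: covered_by_def)
      then have "card {a..y} < card {x..y}"
        using less.prems by (intro psubset_card_mono) (auto simp: psubset_eq)
      then show ?thesis using less.hyps a maximal_chain_snoc[OF r] by blast
    qed
    have M: "left_modular_chain x top (root_chain r)"
      using left_modular_chain_root_chain assms(1) r .
    obtain a0 where a0: "covered_by x a0" "a0 = inf y (least_above (root_chain r) a0)"
      and a0_less: "\<And>a. covered_by x a \<Longrightarrow> a \<le> y \<Longrightarrow> a \<noteq> a0 \<Longrightarrow>
        least_above (root_chain r) a0 < least_above (root_chain r) a"
      using ex_first_atom[OF M \<open>x < y\<close> top_greatest] by blast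
    have "a0 \<le> y" using a0(2) by (metis inf.cobounded1)
    then obtain c where c: "maximal_chain a0 y c" "increasing_chain ?l (r @ [a0]) c"
      and c_min: "\<And>c'. maximal_chain a0 y c' \<Longrightarrow> c' \<noteq> c \<Longrightarrow>
        \<not> increasing_chain ?l (r @ [a0]) c' \<and>
        ord_class.lexordp (chain_word ?l (r @ [a0]) c) (chain_word ?l (r @ [a0]) c')"
      using IH[OF a0(1)] by blast
    \<comment> \<open>The word of \<open>c\<close> is increasing, so only its first letter has to be
      compared with the label of \<open>a0\<close>.\<close>
    have "\<forall>k\<in>set (chain_word ?l (r @ [a0]) c). ?l r a0 < k"
    proof (cases "a0 = y")
      case True
      then have "c = [y]" using c(1) by (simp add: maximal_chain_refl_iff)
      then show ?thesis by simp
    next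
      case False
      then obtain b d where b: "c = a0 # d" "covered_by a0 b" "maximal_chain b y d"
        using c(1) maximal_chain_Cons_iff by metis
      then have "?l r a0 < ?l (r @ [a0]) b"
        using comodernistic_labeling_first_atom_less[OF assms(1) r a0] maximal_chain_le by blast
      with c(2) b show ?thesis
        unfolding increasing_chain_def by (auto simp: chain_word_Cons[OF b(3)])
    qed
    then have inc: "increasing_chain ?l r (x # c)"
      using c by (simp add: increasing_chain_Cons_iff)
    have max: "maximal_chain x y (x # c)"
      using False a0(1) c(1) maximal_chain_Cons_iff by metis
    have other: "\<not> increasing_chain ?l r c' \<and>
        ord_class.lexordp (chain_word ?l r (x # c)) (chain_word ?l r c')"
      if c': "maximal_chain x y c'" "c' \<noteq> x # c" for c'
    proof -
      obtain a d where a: "c' = x # d" "covered_by x a" "maximal_chain a y d"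
        using c'(1) False maximal_chain_Cons_iff by metis
      have "a \<le> y" using a(3) by (rule maximal_chain_le)
      show ?thesis
      proof (cases "a = a0")
        case True
        then have "d \<noteq> c" using a(1) c'(2) by simp
        then show ?thesis
          using c_min[of d] a(1,3) c(1) True
          by (simp add: increasing_chain_Cons_iff[where y = y] chain_word_Cons[where y = y])
      next
        case neq: False
        have less: "least_above (root_chain r) a0 < least_above (root_chain r) a"
          using a0_less a(2) \<open>a \<le> y\<close> neq .
        then have "?l r a0 < ?l r a"
          by (simp add: comodernistic_labeling_def card_atMost_less)
        \<comment> \<open>The words already differ strictly in their first letters.\<close>
        then have lex: "ord_class.lexordp (chain_word ?l r (x # c)) (chain_word ?l r c')"
          using a c(1) by (simp add: chain_word_Cons[where y = y])
        obtain b where b: "covered_by a b" "b \<le> y" "?l (r @ [a]) b \<le> ?l r a"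
          using ex_descent_after_other_atom[OF assms(1) r a(2) \<open>a \<le> y\<close> a0(1) \<open>a0 \<le> y\<close> _ less]
            neq by metis
        then have "a \<noteq> y" by (auto simp: covered_by_def)
        have "\<not> increasing_chain ?l r c'"
        proof
          assume "increasing_chain ?l r c'"
          then have d: "increasing_chain ?l (r @ [a]) d"
            and gt: "\<forall>k\<in>set (chain_word ?l (r @ [a]) d). ?l r a < k"
            using a by (auto simp: increasing_chain_Cons_iff)
          \<comment> \<open>The cover \<open>b\<close> is completed to a maximal chain
            \<open>a # e\<close> that can be compared with \<open>d\<close>. By induction the
            increasing chain \<open>d\<close> is lexicographically first over \<open>a\<close>, so
            its first letter is at most the label of \<open>b\<close>, hence at most that of
            \<open>a\<close>: a contradiction.\<close>
          obtain e where e: "maximal_chain b y e" using ex_maximal_chain[OF b(2)] by blast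
          then have ae: "maximal_chain a y (a # e)"
            using \<open>a \<noteq> y\<close> b(1) maximal_chain_Cons_iff by metis
          obtain b' d' where d': "d = a # d'" "maximal_chain b' y d'"
            using a(3) \<open>a \<noteq> y\<close> maximal_chain_Cons_iff by metis
          have "hd (chain_word ?l (r @ [a]) d) \<le> ?l (r @ [a]) b"
          proof (cases "a # e = d")
            case True
            then show ?thesis using chain_word_Cons[OF e, of ?l "r @ [a]" a] by simp
          next
            case False
            then have "ord_class.lexordp (chain_word ?l (r @ [a]) d) (chain_word ?l (r @ [a]) (a # e))"
              using IH[OF a(2) \<open>a \<le> y\<close>] a(3) d ae by metis
            then show ?thesis
              using d'(1) by (auto simp: chain_word_Cons[OF e] chain_word_Cons[OF d'(2)])
          qed
          moreover have "?l r a < hd (chain_word ?l (r @ [a]) d)"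
            using gt d' by (simp add: chain_word_Cons[OF d'(2)])
          ultimately show False using b(3) by simp
        qed
        with lex show ?thesis by blast
      qed
    qed
    show ?thesis using inc max other by blast
  qed
qed

theorem theorem1p2:
  assumes "comodernistic TYPE('a::{finite,bounded_lattice})"
  shows "\<exists>l :: 'a chain_edge_labeling. CL_labeling l"
proof
  show "CL_labeling (comodernistic_labeling :: 'a chain_edge_labeling)"
    unfolding CL_labeling_def
  proof (intro allI impI)
    fix x y :: 'a and r
    assume "x \<le> y" "maximal_chain bot x r"
    from comodernistic_labeling_increasing_chain[OF assms this]
    show "(\<exists>!c. maximal_chain x y c \<and> increasing_chain comodernistic_labeling r c) \<and>
      (\<forall>c c'. maximal_chain x y c \<and> increasing_chain comodernistic_labeling r c \<and>
        maximal_chain x y c' \<and> c' \<noteq> c \<longrightarrow>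
        ord_class.lexordp (chain_word comodernistic_labeling r c)
          (chain_word comodernistic_labeling r c'))"
      by metis
  qed
qed

end
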